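(* For every positive integer $n$, $i(n) \ge \dfrac{n}{56} - 1$.
   Context: An irreducible pair of partitions of $n$ is an (unordered) pair of partitions $\lambda=(\lambda_1,\dots,\lambda_r)$ and $\mu=(\mu_1,\dots,\mu_s)$ of $n$ that yield the same multinomial coefficient, i.e. $\lambda_1!\cdots\lambda_r! = \mu_1!\cdots\mu_s!$, and have no part in common. $i(n)$ is the total number of irreducible pairs of partitions of $n$. *)

theory Defs
  imports Complex_Main "HOL-Library.Multiset"
begin

definition partition_of :: "nat \<Rightarrow> nat multiset \<Rightarrow> bool" where
  "partition_of n p \<longleftrightarrow> (\<forall>k \<in># p. k > 0) \<and> sum_mset p = n"

definition fact_prod :: "nat multiset \<Rightarrow> nat" where
  "fact_prod p = (\<Prod>k\<in>#p. fact k)"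

text \<open>Two partitions of the same number \<open>n\<close> have the same multinomial coefficient iff their
  values of \<open>fact_prod\<close> agree.\<close>

definition irreducible_pair :: "nat \<Rightarrow> nat multiset \<Rightarrow> nat multiset \<Rightarrow> bool" where
  "irreducible_pair n p q \<longleftrightarrow> partition_of n p \<and> partition_of n q \<and>
     fact_prod p = fact_prod q \<and> set_mset p \<inter> set_mset q = {}"

text \<open>An unordered pair is encoded as the set of its two components.\<close>

definition irreducible_pairs :: "nat \<Rightarrow> nat multiset set set" where
  "irreducible_pairs n = {{p, q} | p q. irreducible_pair n p q}"

definition num_irreducible_pairs :: "nat \<Rightarrow> nat" where
  "num_irreducible_pairs n = card (irreducible_pairs n)"

text \<open>The counted set is finite, so \<open>card\<close> has its intended meaning.\<close>

lemma finite_partitions: "finite {p. partition_of n p}"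
proof -
  have size_le: "size p \<le> sum_mset p" if "\<forall>k \<in># p. k > 0" for p :: "nat multiset"
    using that by (induction p) auto
  have part_le: "k \<le> sum_mset p" if "k \<in># p" for k and p :: "nat multiset"
    using that by (auto dest!: multi_member_split)
  have "{p. partition_of n p} \<subseteq> mset ` {xs. set xs \<subseteq> {..n} \<and> length xs \<le> n}"
  proof
    fix p assume "p \<in> {p. partition_of n p}"
    moreover obtain xs where "p = mset xs" by (metis ex_mset)
    ultimately show "p \<in> mset ` {xs. set xs \<subseteq> {..n} \<and> length xs \<le> n}"
      using size_le[of p] part_le[of _ p] by (auto simp: partition_of_def)
  qed
  then show ?thesis
    by (rule finite_subset) (intro finite_imageI finite_lists_length_le finite_atMost)
qed

lemma finite_irreducible_pairs: "finite (irreducible_pairs n)"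
  by (rule finite_subset[of _ "Pow {p. partition_of n p}"])
     (auto simp: irreducible_pairs_def irreducible_pair_def finite_partitions)

end

theory Submission
  imports Defs
begin

text \<open>Since \<open>4! 1!\<^sup>3 = 3! 2!\<^sup>2\<close> with \<open>4 + 3 = 3 + 4 = 7\<close> and \<open>6! 1!\<^sup>2 = 5! 3!\<close> with
  \<open>6 + 2 = 5 + 3 = 8\<close>, and since \<open>{4, 6, 1}\<close> and \<open>{3, 2, 5}\<close> are disjoint, taking \<open>a\<close> copies of the
  first identity and \<open>b\<close> copies of the second gives an irreducible pair of \<open>7 a + 8 b\<close>.
  The equation \<open>7 a + 8 b = n\<close> has at least \<open>\<lfloor>n / 56\<rfloor>\<close> solutions in natural numbers.\<close>

definition left_part :: "nat \<Rightarrow> nat \<Rightarrow> nat multiset" where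
  "left_part a b = replicate_mset a 4 + replicate_mset b 6 + replicate_mset (3 * a + 2 * b) 1"

definition right_part :: "nat \<Rightarrow> nat \<Rightarrow> nat multiset" where
  "right_part a b = replicate_mset (a + b) 3 + replicate_mset (2 * a) 2 + replicate_mset b 5"

lemma fact_prod_union: "fact_prod (p + q) = fact_prod p * fact_prod q"
  by (simp add: fact_prod_def)

lemma fact_prod_replicate: "fact_prod (replicate_mset k m) = fact m ^ k"
  by (simp add: fact_prod_def)

lemma fact_prod_left_right: "fact_prod (left_part a b) = fact_prod (right_part a b)"
proof -
  have "fact_prod (left_part a b) = 24 ^ a * 720 ^ b"
    by (simp add: left_part_def fact_prod_union fact_prod_replicate fact_numeral)
  also have "\<dots> = (6 * 4) ^ a * (6 * 120) ^ b"
    by simp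
  also have "\<dots> = 6 ^ (a + b) * 2 ^ (2 * a) * 120 ^ b"
    unfolding power_mult_distrib power_add by (simp add: power_mult)
  also have "\<dots> = fact_prod (right_part a b)"
    by (simp add: right_part_def fact_prod_union fact_prod_replicate fact_numeral)
  finally show ?thesis .
qed

lemma irreducible_pair_left_right:
  "irreducible_pair (7 * a + 8 * b) (left_part a b) (right_part a b)"
proof -
  have "partition_of (7 * a + 8 * b) (left_part a b)"
    by (auto simp: partition_of_def left_part_def in_replicate_mset)
  moreover have "partition_of (7 * a + 8 * b) (right_part a b)"
    by (auto simp: partition_of_def right_part_def in_replicate_mset)
  moreover have "set_mset (left_part a b) \<inter> set_mset (right_part a b) = {}"
    by (auto simp: left_part_def right_part_def in_replicate_mset)
  ultimately show ?thesis
    by (simp add: irreducible_pair_def fact_prod_left_right)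
qed

text \<open>The multiplicities of 4 and 6 in a left part are \<open>a\<close> and \<open>b\<close>,
  while a right part contains neither number. So if the two components are swapped, all four
  parameters are 0.\<close>

lemma left_right_pair_inject:
  assumes "{left_part a b, right_part a b} = {left_part a' b', right_part a' b'}"
  shows "a = a' \<and> b = b'"
proof -
  have counts: "count (left_part x y) 4 = x" "count (left_part x y) 6 = y"
    "count (right_part x y) 4 = 0" "count (right_part x y) 6 = 0" for x y
    by (simp_all add: left_part_def right_part_def)
  show ?thesis
    using assms by (metis counts doubleton_eq_iff)
qed

lemma num_irreducible_pairs_ge: "n div 56 \<le> num_irreducible_pairs n"
proof -
  obtain m r where n: "n = 7 * m + r" and "r < 7"
    by (metis mult_div_mod_eq mod_less_divisor zero_less_numeral)
  \<comment> \<open>As 7(m - r) + 8r = 7m + r, the case j = 0 solves the equation; each further step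
    trades eight 7s for seven 8s.\<close>
  define a where "a j = m - (r + 8 * j)" for j
  define b where "b j = r + 7 * j" for j
  define f where "f j = {left_part (a j) (b j), right_part (a j) (b j)}" for j
  have sum_n: "7 * a j + 8 * b j = n" if "j < n div 56" for j
  proof -
    \<comment> \<open>This bound keeps the natural subtraction in \<open>a j\<close> from
      truncating: with r < 7 it forces m \<ge> 8j + 8.\<close>
    have "56 * j + 56 \<le> n"
      using that by linarith
    then have "r + 8 * j \<le> m"
      using n \<open>r < 7\<close> by linarith
    then have "m = a j + r + 8 * j"
      unfolding a_def by linarith
    then show ?thesis
      unfolding n b_def by simp
  qed
  have "f j \<in> irreducible_pairs n" if "j < n div 56" for j
    using irreducible_pair_left_right[of "a j" "b j"] sum_n[OF that]
    unfolding f_def irreducible_pairs_def by auto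
  then have "f ` {..<n div 56} \<subseteq> irreducible_pairs n"
    by auto
  \<comment> \<open>The second parameter \<open>b j\<close> alone already determines j.\<close>
  moreover have "inj_on f {..<n div 56}"
    unfolding f_def b_def by (auto intro!: inj_onI dest!: left_right_pair_inject)
  ultimately show ?thesis
    unfolding num_irreducible_pairs_def
    using card_inj_on_le[of f "{..<n div 56}"] finite_irreducible_pairs by simp
qed

theorem theorem13:
  fixes n :: nat
  assumes "n > 0"
  shows "real (num_irreducible_pairs n) \<ge> real n / 56 - 1"
proof -
  have "n \<le> 56 * num_irreducible_pairs n + 56"
    using num_irreducible_pairs_ge[of n] by linarith
  then have "real n \<le> 56 * real (num_irreducible_pairs n) + 56"
    by linarith
  then show ?thesis
    by simp
qed

end
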